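(* Let $\langle F,E\rangle$ be a weak-* sequentially complete anti-dual pair and let $A,B\in\mathscr L(E;F)$ be positive operators. Let $B_a$ be the canonical $A$-absolutely continuous part of $B$ and $A_a$ the canonical $B$-absolutely continuous part of $A$. Then $$A_a\ll B_a\qquad\text{and}\qquad B_a\ll A_a.$$
   Context: An anti-dual pair $\langle F,E\rangle$ consists of complex vector spaces $E,F$ and a map $\langle\cdot,\cdot\rangle:F\times E\to\mathbb C$, linear in the first and conjugate linear in the second variable, that separates the points of $E$ and of $F$. $\sigma(F,E)$ is the weak topology on $F$ induced by the functionals $\langle\cdot,x\rangle$ ($x\in E$), and $\sigma(E,F)$ is the weak topology on $E$ induced by the functionals $\langle f,\cdot\rangle$ ($f\in F$). The pair is weak-* sequentially complete if every Cauchy sequence of $(F,\sigma(F,E))$ converges. $\mathscr L(E;F)$ is the set of $\sigma(E,F)$-$\sigma(F,E)$ continuous linear operators $E\to F$. A linear operator $A:E\to F$ is positive if $\langle Ax,x\rangle\ge0$ for all $x\in E$ (such operators belong to $\mathscr L(E;F)$ automatically). Absolute continuity: $B\ll A$ if for every sequence $(x_n)$ in $E$, $\langle Ax_n,x_n\rangle\to0$ and $\langle B(x_n-x_m),x_n-x_m\rangle\to0$ ($n,m\to\infty$) imply $\langle Bx_n,x_n\rangle\to0$. Auxiliary Hilbert spaces: for a positive $A$, $\mathcal H_A$ is the Hilbert completion of $\operatorname{ran}A$ under the (well-defined) inner product $(Ax\,|\,Ay)_A:=\langle Ax,y\rangle$. $J_A:\mathcal H_A\to F$ is the unique weakly continuous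 (weak topology of $\mathcal H_A$ to $\sigma(F,E)$) linear extension of the inclusion $\operatorname{ran}A\hookrightarrow F$; its adjoint $J_A^*:E\to\mathcal H_A$, determined by $\langle J_Ah,x\rangle=(h\,|\,J_A^*x)_A$, satisfies $J_A^*x=Ax$, and $A=J_AJ_A^*$. $\mathcal H_B$, $J_B$ are defined likewise. The canonical absolutely continuous part of $B$ with respect to $A$ is $B_a:=J_B(I-P)J_B^*$, where $P$ is the orthogonal projection of $\mathcal H_B$ onto the closed subspace $\{\xi\in\mathcal H_B:(0,\xi)\in\overline{\{(Ax,Bx):x\in E\}}\}$ (closure in $\mathcal H_A\times\mathcal H_B$). The canonical absolutely continuous part $A_a$ of $A$ with respect to $B$ is obtained by interchanging the roles of $A$ and $B$: $A_a:=J_A(I-Q)J_A^*$, where $Q$ is the orthogonal projection of $\mathcal H_A$ onto $\{\zeta\in\mathcal H_A:(0,\zeta)\in\overline{\{(Bx,Ax):x\in E\}}\}$ (closure in $\mathcal H_B\times\mathcal H_A$). *)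

theory Defs
  imports "HOL-Analysis.Analysis"
begin

section \<open>Anti-dual pairs\<close>

locale anti_dual_pair =
  E: vector_space scaleE + F: vector_space scaleF
  for scaleE :: "complex \<Rightarrow> 'e::ab_group_add \<Rightarrow> 'e"
    and scaleF :: "complex \<Rightarrow> 'f::ab_group_add \<Rightarrow> 'f" +
  fixes pairing :: "'f \<Rightarrow> 'e \<Rightarrow> complex"
  assumes pairing_add_left: "pairing (f + g) x = pairing f x + pairing g x"
    and pairing_scale_left: "pairing (scaleF c f) x = c * pairing f x"
    and pairing_add_right: "pairing f (x + y) = pairing f x + pairing f y"
    and pairing_scale_right: "pairing f (scaleE c x) = cnj c * pairing f x"
    and separates_left: "(\<And>x. pairing f x = 0) \<Longrightarrow> f = 0"
    and separates_right: "(\<And>f. pairing f x = 0) \<Longrightarrow> x = 0"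

definition weak_topology :: "('a \<Rightarrow> complex) set \<Rightarrow> 'a topology" where
  "weak_topology \<Phi> = topology_generated_by {\<phi> -` U |\<phi> U. \<phi> \<in> \<Phi> \<and> open U}"

definition sigma_FE :: "('f \<Rightarrow> 'e \<Rightarrow> complex) \<Rightarrow> 'f topology" where
  "sigma_FE pairing = weak_topology {(\<lambda>f. pairing f x) |x. True}"

definition sigma_EF :: "('f \<Rightarrow> 'e \<Rightarrow> complex) \<Rightarrow> 'e topology" where
  "sigma_EF pairing = weak_topology {(\<lambda>x. pairing f x) |f. True}"

text \<open>Cauchy sequences with respect to the uniformity of a vector topology.\<close>

definition tvs_Cauchy :: "'a::ab_group_add topology \<Rightarrow> (nat \<Rightarrow> 'a) \<Rightarrow> bool" where
  "tvs_Cauchy T s \<longleftrightarrow>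
     (\<forall>U. openin T U \<and> 0 \<in> U \<longrightarrow> (\<exists>N. \<forall>m\<ge>N. \<forall>n\<ge>N. s m - s n \<in> U))"

definition weak_star_sequentially_complete ::
    "('f::ab_group_add \<Rightarrow> 'e \<Rightarrow> complex) \<Rightarrow> bool" where
  "weak_star_sequentially_complete pairing \<longleftrightarrow>
     (\<forall>s. tvs_Cauchy (sigma_FE pairing) s \<longrightarrow>
          (\<exists>l. limitin (sigma_FE pairing) s l sequentially))"

definition continuous_operators ::
    "(complex \<Rightarrow> 'e::ab_group_add \<Rightarrow> 'e) \<Rightarrow> (complex \<Rightarrow> 'f::ab_group_add \<Rightarrow> 'f) \<Rightarrow>
     ('f \<Rightarrow> 'e \<Rightarrow> complex) \<Rightarrow> ('e \<Rightarrow> 'f) set" where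
  "continuous_operators scaleE scaleF pairing =
     {A. Vector_Spaces.linear scaleE scaleF A \<and>
         continuous_map (sigma_EF pairing) (sigma_FE pairing) A}"

definition positive_operator :: "('f \<Rightarrow> 'e \<Rightarrow> complex) \<Rightarrow> ('e \<Rightarrow> 'f) \<Rightarrow> bool" where
  "positive_operator pairing A \<longleftrightarrow> (\<forall>x. pairing (A x) x \<in> \<real>\<^sub>\<ge>\<^sub>0)"

text \<open>\<open>abs_continuous pairing B A\<close> is \<open>B \<lless> A\<close>.\<close>

definition abs_continuous ::
    "('f \<Rightarrow> 'e::ab_group_add \<Rightarrow> complex) \<Rightarrow> ('e \<Rightarrow> 'f) \<Rightarrow> ('e \<Rightarrow> 'f) \<Rightarrow> bool" where
  "abs_continuous pairing B A \<longleftrightarrow>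
     (\<forall>x :: nat \<Rightarrow> 'e.
        (\<lambda>n. pairing (A (x n)) (x n)) \<longlonglongrightarrow> 0 \<longrightarrow>
        ((\<lambda>(n, m). pairing (B (x n - x m)) (x n - x m)) \<longlongrightarrow> 0) (sequentially \<times>\<^sub>F sequentially) \<longrightarrow>
        (\<lambda>n. pairing (B (x n)) (x n)) \<longlonglongrightarrow> 0)"


section \<open>Complex Hilbert spaces\<close>

text \<open>
  A Hilbert space is carried by a linear subspace \<open>hset\<close> of an ambient complex vector
  space, so that one type can accommodate Hilbert spaces depending on an operator.
  The inner product is linear in the first variable and only matters on \<open>hset\<close>.
\<close>

record 'h hilbert =
  hset :: "'h set"
  hscale :: "complex \<Rightarrow> 'h \<Rightarrow> 'h"
  hinner :: "'h \<Rightarrow> 'h \<Rightarrow> complex"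

text \<open>
  \<open>Metric_space\<close> demands symmetry and nonnegativity of the distance on the whole type,
  hence the value \<open>0\<close> outside \<open>hset\<close>.
\<close>

definition hdist :: "('h::ab_group_add, 'm) hilbert_scheme \<Rightarrow> 'h \<Rightarrow> 'h \<Rightarrow> real" where
  "hdist H x y =
     (if x \<in> hset H \<and> y \<in> hset H then sqrt (Re (hinner H (x - y) (x - y))) else 0)"

abbreviation htopology :: "('h::ab_group_add, 'm) hilbert_scheme \<Rightarrow> 'h topology" where
  "htopology H \<equiv> Metric_space.mtopology (hset H) (hdist H)"

definition complex_hilbert :: "('h::ab_group_add, 'm) hilbert_scheme \<Rightarrow> bool" where
  "complex_hilbert H \<longleftrightarrow>
     vector_space (hscale H) \<and>
     module.subspace (hscale H) (hset H) \<and>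
     (\<forall>x\<in>hset H. \<forall>y\<in>hset H. \<forall>z\<in>hset H. hinner H (x + y) z = hinner H x z + hinner H y z) \<and>
     (\<forall>c. \<forall>x\<in>hset H. \<forall>y\<in>hset H. hinner H (hscale H c x) y = c * hinner H x y) \<and>
     (\<forall>x\<in>hset H. \<forall>y\<in>hset H. hinner H y x = cnj (hinner H x y)) \<and>
     (\<forall>x\<in>hset H. hinner H x x \<in> \<real>\<^sub>\<ge>\<^sub>0) \<and>
     (\<forall>x\<in>hset H. hinner H x x = 0 \<longrightarrow> x = 0) \<and>
     Metric_space.mcomplete (hset H) (hdist H)"

definition hweak_topology :: "('h, 'm) hilbert_scheme \<Rightarrow> 'h topology" where
  "hweak_topology H =
     subtopology (weak_topology {(\<lambda>h. hinner H h k) |k. k \<in> hset H}) (hset H)"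

definition linear_on ::
    "'a set \<Rightarrow> (complex \<Rightarrow> 'a::ab_group_add \<Rightarrow> 'a) \<Rightarrow> (complex \<Rightarrow> 'b::ab_group_add \<Rightarrow> 'b) \<Rightarrow>
     ('a \<Rightarrow> 'b) \<Rightarrow> bool" where
  "linear_on S s1 s2 T \<longleftrightarrow>
     (\<forall>x\<in>S. \<forall>y\<in>S. T (x + y) = T x + T y) \<and> (\<forall>c. \<forall>x\<in>S. T (s1 c x) = s2 c (T x))"

text \<open>Orthogonal projection of \<open>x \<in> hset H\<close> onto a closed subspace \<open>M\<close> of \<open>H\<close>.\<close>

definition orth_proj :: "('h::ab_group_add, 'm) hilbert_scheme \<Rightarrow> 'h set \<Rightarrow> 'h \<Rightarrow> 'h" where
  "orth_proj H M x = (THE p. p \<in> M \<and> (\<forall>m\<in>M. hinner H (x - p) m = 0))"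


section \<open>The auxiliary Hilbert space of a positive operator\<close>

text \<open>
  A completion comes with the embedding \<open>emb\<close> of the inner product space
  \<open>ran A\<close>, whose inner product is \<open>(A x | A y) = \<langle>A x, y\<rangle>\<close>, onto a dense subspace.
\<close>

record ('f, 'h) completion = "'h hilbert" +
  emb :: "'f \<Rightarrow> 'h"

definition hilbert_completion ::
    "(complex \<Rightarrow> 'f::ab_group_add \<Rightarrow> 'f) \<Rightarrow> ('f \<Rightarrow> 'e \<Rightarrow> complex) \<Rightarrow> ('e \<Rightarrow> 'f) \<Rightarrow>
     ('f, 'h::ab_group_add) completion \<Rightarrow> bool" where
  "hilbert_completion scaleF pairing A H \<longleftrightarrow>
     complex_hilbert H \<and>
     emb H ` range A \<subseteq> hset H \<and>
     linear_on (range A) scaleF (hscale H) (emb H) \<and>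
     (\<forall>x y. hinner H (emb H (A x)) (emb H (A y)) = pairing (A x) y) \<and>
     htopology H closure_of (emb H ` range A) = hset H"

text \<open>\<open>J_op\<close> is \<open>J\<^sub>A\<close>; being extensional makes it unique as a total HOL function.\<close>

definition J_op ::
    "(complex \<Rightarrow> 'f::ab_group_add \<Rightarrow> 'f) \<Rightarrow> ('f \<Rightarrow> 'e \<Rightarrow> complex) \<Rightarrow> ('e \<Rightarrow> 'f) \<Rightarrow>
     ('f, 'h::ab_group_add) completion \<Rightarrow> 'h \<Rightarrow> 'f" where
  "J_op scaleF pairing A H =
     (THE J. J \<in> extensional (hset H) \<and>
             linear_on (hset H) (hscale H) scaleF J \<and>
             continuous_map (hweak_topology H) (sigma_FE pairing) J \<and>
             (\<forall>f\<in>range A. J (emb H f) = f))"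

definition J_adj ::
    "(complex \<Rightarrow> 'f::ab_group_add \<Rightarrow> 'f) \<Rightarrow> ('f \<Rightarrow> 'e \<Rightarrow> complex) \<Rightarrow> ('e \<Rightarrow> 'f) \<Rightarrow>
     ('f, 'h::ab_group_add) completion \<Rightarrow> 'e \<Rightarrow> 'h" where
  "J_adj scaleF pairing A H =
     (THE T. (\<forall>x. T x \<in> hset H) \<and>
             (\<forall>h\<in>hset H. \<forall>x. pairing (J_op scaleF pairing A H h) x = hinner H h (T x)))"


section \<open>The canonical absolutely continuous part\<close>

definition multivalued_part ::
    "('e \<Rightarrow> 'f) \<Rightarrow> ('f, 'h::ab_group_add) completion \<Rightarrow>
     ('e \<Rightarrow> 'f) \<Rightarrow> ('f, 'k::ab_group_add) completion \<Rightarrow> 'k set" where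
  "multivalued_part A HA B HB =
     {\<xi> \<in> hset HB. (0, \<xi>) \<in> prod_topology (htopology HA) (htopology HB) closure_of
                         {(emb HA (A x), emb HB (B x)) |x. True}}"

text \<open>The canonical absolutely continuous part of \<open>B\<close> with respect to \<open>A\<close>.\<close>

definition ac_part ::
    "(complex \<Rightarrow> 'f::ab_group_add \<Rightarrow> 'f) \<Rightarrow> ('f \<Rightarrow> 'e \<Rightarrow> complex) \<Rightarrow>
     ('e \<Rightarrow> 'f) \<Rightarrow> ('f, 'h::ab_group_add) completion \<Rightarrow>
     ('e \<Rightarrow> 'f) \<Rightarrow> ('f, 'k::ab_group_add) completion \<Rightarrow> 'e \<Rightarrow> 'f" where
  "ac_part scaleF pairing A HA B HB x =
     (let v = J_adj scaleF pairing B HB x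
      in J_op scaleF pairing B HB (v - orth_proj HB (multivalued_part A HA B HB) v))"

end

theory Submission
  imports Defs
begin

text \<open>
  Let \<open>T\<close> be the closure of \<open>{(Ax, Bx)}\<close> in the product of the two auxiliary Hilbert spaces.
  It is a closed subspace containing \<open>(Ax, Bx)\<close>, \<open>(0, PBx)\<close> and \<open>(QAx, 0)\<close>, hence also
  \<open>((I - Q)Ax, (I - P)Bx)\<close>, whose components have the squared norms \<open>\<langle>A\<^sub>a x, x\<rangle>\<close> and
  \<open>\<langle>B\<^sub>a x, x\<rangle>\<close>. If along a sequence the second component tends to \<open>0\<close> and the first one is
  Cauchy with limit \<open>\<zeta>\<close>, then \<open>(\<zeta>, 0)\<close> lies in \<open>T\<close>, so \<open>\<zeta>\<close> belongs to the range of \<open>Q\<close>; being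
  also orthogonal to it, \<open>\<zeta>\<close> vanishes.
\<close>

section \<open>Hilbert spaces on a carrier\<close>

locale hilbert_carrier =
  fixes H :: "('h::ab_group_add, 'm) hilbert_scheme"
  assumes complex_hilbert: "complex_hilbert H"
begin

definition nrm :: "'h \<Rightarrow> real" where
  "nrm x = sqrt (Re (hinner H x x))"

sublocale V: vector_space "hscale H"
  using complex_hilbert unfolding complex_hilbert_def by blast

lemma subspace_hset: "V.subspace (hset H)"
  using complex_hilbert unfolding complex_hilbert_def by blast

lemma hset_zero [simp]: "0 \<in> hset H"
  and hset_add [simp]: "x \<in> hset H \<Longrightarrow> y \<in> hset H \<Longrightarrow> x + y \<in> hset H"
  and hset_diff [simp]: "x \<in> hset H \<Longrightarrow> y \<in> hset H \<Longrightarrow> x - y \<in> hset H"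
  and hset_minus [simp]: "x \<in> hset H \<Longrightarrow> - x \<in> hset H"
  and hset_scale [simp]: "x \<in> hset H \<Longrightarrow> hscale H c x \<in> hset H"
  using subspace_hset
  by (auto intro: V.subspace_0 V.subspace_add V.subspace_diff V.subspace_neg V.subspace_scale)

lemma inner_add_left:
    "x \<in> hset H \<Longrightarrow> y \<in> hset H \<Longrightarrow> z \<in> hset H \<Longrightarrow> hinner H (x + y) z = hinner H x z + hinner H y z"
  and inner_scale_left:
    "x \<in> hset H \<Longrightarrow> y \<in> hset H \<Longrightarrow> hinner H (hscale H c x) y = c * hinner H x y"
  and inner_commute: "x \<in> hset H \<Longrightarrow> y \<in> hset H \<Longrightarrow> hinner H y x = cnj (hinner H x y)"
  and inner_self_nonneg: "x \<in> hset H \<Longrightarrow> hinner H x x \<in> \<real>\<^sub>\<ge>\<^sub>0"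
  and inner_self_eq_0: "x \<in> hset H \<Longrightarrow> hinner H x x = 0 \<Longrightarrow> x = 0"
  and mcomplete: "Metric_space.mcomplete (hset H) (hdist H)"
  using complex_hilbert[unfolded complex_hilbert_def] by (elim conjE, meson)+

section \<open>Sesquilinear identities and the induced norm\<close>

lemma inner_minus_left:
  "x \<in> hset H \<Longrightarrow> z \<in> hset H \<Longrightarrow> hinner H (- x) z = - hinner H x z"
  using inner_scale_left[of x z "- 1"] by simp

lemma inner_diff_left:
  "x \<in> hset H \<Longrightarrow> y \<in> hset H \<Longrightarrow> z \<in> hset H \<Longrightarrow> hinner H (x - y) z = hinner H x z - hinner H y z"
  using inner_add_left[of x "- y" z] by (simp add: inner_minus_left)

lemma inner_add_right:
  "x \<in> hset H \<Longrightarrow> y \<in> hset H \<Longrightarrow> z \<in> hset H \<Longrightarrow> hinner H z (x + y) = hinner H z x + hinner H z y"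
  using inner_commute[of "x + y" z] inner_commute[of x z] inner_commute[of y z]
  by (simp add: inner_add_left)

lemma inner_diff_right:
  "x \<in> hset H \<Longrightarrow> y \<in> hset H \<Longrightarrow> z \<in> hset H \<Longrightarrow> hinner H z (x - y) = hinner H z x - hinner H z y"
  using inner_commute[of "x - y" z] inner_commute[of x z] inner_commute[of y z]
  by (simp add: inner_diff_left)

lemma inner_scale_right:
  "x \<in> hset H \<Longrightarrow> y \<in> hset H \<Longrightarrow> hinner H x (hscale H c y) = cnj c * hinner H x y"
  using inner_commute[of "hscale H c y" x] inner_commute[of y x]
  by (simp add: inner_scale_left)

lemma inner_zero_left [simp]: "y \<in> hset H \<Longrightarrow> hinner H 0 y = 0"
  using inner_diff_left[of 0 0 y] by simp

lemma inner_zero_right [simp]: "y \<in> hset H \<Longrightarrow> hinner H y 0 = 0"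
  using inner_diff_right[of 0 0 y] by simp

lemma inner_self: "x \<in> hset H \<Longrightarrow> hinner H x x = of_real ((nrm x)\<^sup>2)"
  using inner_self_nonneg[of x]
  by (auto simp: nrm_def complex_eq_iff elim!: nonneg_Reals_cases)

lemma nrm_nonneg [simp]: "x \<in> hset H \<Longrightarrow> 0 \<le> nrm x"
  using inner_self_nonneg[of x] by (auto simp: nrm_def elim!: nonneg_Reals_cases)

lemma nrm_zero [simp]: "nrm 0 = 0"
  by (simp add: nrm_def)

lemma nrm_eq_0: "x \<in> hset H \<Longrightarrow> nrm x = 0 \<longleftrightarrow> x = 0"
  using inner_self_eq_0[of x] by (auto simp: inner_self)

lemma nrm_scale: "x \<in> hset H \<Longrightarrow> nrm (hscale H c x) = cmod c * nrm x"
proof -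
  assume x: "x \<in> hset H"
  have "complex_of_real ((nrm (hscale H c x))\<^sup>2) = c * (cnj c * hinner H x x)"
    using x inner_self[of "hscale H c x"] by (simp add: inner_scale_left inner_scale_right mult.left_commute)
  also have "\<dots> = of_real ((cmod c * nrm x)\<^sup>2)"
    using x complex_norm_square[of c] by (simp add: inner_self power_mult_distrib)
  finally have "(nrm (hscale H c x))\<^sup>2 = (cmod c * nrm x)\<^sup>2"
    by (simp only: of_real_eq_iff)
  then show ?thesis using x by simp
qed

lemma nrm_minus [simp]: "x \<in> hset H \<Longrightarrow> nrm (- x) = nrm x"
  using nrm_scale[of x "- 1"] by simp

lemma nrm_minus_commute: "x \<in> hset H \<Longrightarrow> y \<in> hset H \<Longrightarrow> nrm (x - y) = nrm (y - x)"
  using nrm_minus[of "x - y"] by simp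

lemma nrm_add_sq:
  assumes "x \<in> hset H" "y \<in> hset H"
  shows "(nrm (x + y))\<^sup>2 = (nrm x)\<^sup>2 + 2 * Re (hinner H x y) + (nrm y)\<^sup>2"
proof -
  have "complex_of_real ((nrm (x + y))\<^sup>2)
      = of_real ((nrm x)\<^sup>2) + (hinner H x y + cnj (hinner H x y)) + of_real ((nrm y)\<^sup>2)"
    using assms inner_commute[of x y] inner_self[of "x + y"] inner_self[of x] inner_self[of y]
    by (simp add: inner_add_left inner_add_right add_ac)
  then show ?thesis by (simp add: complex_eq_iff)
qed

lemma nrm_diff_sq:
  assumes "x \<in> hset H" "y \<in> hset H"
  shows "(nrm (x - y))\<^sup>2 = (nrm x)\<^sup>2 - 2 * Re (hinner H x y) + (nrm y)\<^sup>2"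
  using nrm_add_sq[of x "- y"] inner_diff_right[of 0 y x] assms by simp

section \<open>Cauchy-Schwarz and the triangle inequality\<close>

lemma Re_inner_le:
  assumes x: "x \<in> hset H" and y: "y \<in> hset H"
  shows "Re (hinner H x y) \<le> nrm x * nrm y"
proof (cases "nrm x = 0 \<or> nrm y = 0")
  case True
  then show ?thesis using x y by (auto simp: nrm_eq_0)
next
  case False
  then have pos: "nrm x > 0" "nrm y > 0"
    using x y by (auto simp: less_le)
  let ?u = "hscale H (of_real (nrm y)) x" and ?v = "hscale H (of_real (nrm x)) y"
  \<comment> \<open>Both rescaled vectors have norm \<open>nrm x * nrm y\<close>, so the expanded
    square is the desired inequality times a positive factor, which is cancelled at the end.\<close>
  have "0 \<le> (nrm (?u - ?v))\<^sup>2" by simp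
  also have "\<dots> = 2 * (nrm x * nrm y)\<^sup>2 - 2 * (nrm x * nrm y) * Re (hinner H x y)"
    using x y pos
    by (simp add: nrm_diff_sq nrm_scale inner_scale_left inner_scale_right power_mult_distrib)
  finally have "(nrm x * nrm y) * Re (hinner H x y) \<le> (nrm x * nrm y) * (nrm x * nrm y)"
    by (simp add: power2_eq_square)
  then show ?thesis using pos by (simp add: mult_le_cancel_left_pos)
qed

lemma Cauchy_Schwarz:
  assumes x: "x \<in> hset H" and y: "y \<in> hset H"
  shows "cmod (hinner H x y) \<le> nrm x * nrm y"
proof (cases "hinner H x y = 0")
  case True
  then show ?thesis using x y by simp
next
  case False
  \<comment> \<open>Rotating x by this unimodular factor makes the inner product real and equal to
    its modulus without changing the norm of x.\<close>
  let ?c = "cnj (sgn (hinner H x y))"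
  have "?c * hinner H x y = of_real (cmod (hinner H x y))"
    using complex_norm_square[of "hinner H x y"] False
    by (simp add: sgn_eq field_simps power2_eq_square)
  then have "cmod (hinner H x y) = Re (hinner H (hscale H ?c x) y)"
    using x y by (simp add: inner_scale_left)
  also have "\<dots> \<le> nrm (hscale H ?c x) * nrm y"
    using x y by (intro Re_inner_le) auto
  also have "nrm (hscale H ?c x) = nrm x"
    using x False by (simp add: nrm_scale norm_sgn)
  finally show ?thesis .
qed

lemma nrm_triangle:
  assumes x: "x \<in> hset H" and y: "y \<in> hset H"
  shows "nrm (x + y) \<le> nrm x + nrm y"
proof (rule power2_le_imp_le)
  show "(nrm (x + y))\<^sup>2 \<le> (nrm x + nrm y)\<^sup>2"
    using Re_inner_le[OF x y] nrm_add_sq[OF x y] by (simp add: power2_sum)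
qed (use x y in simp)

lemma nrm_triangle_diff:
  assumes "x \<in> hset H" "y \<in> hset H" "z \<in> hset H"
  shows "nrm (x - z) \<le> nrm (x - y) + nrm (y - z)"
  using nrm_triangle[of "x - y" "y - z"] assms by simp

section \<open>The metric of the carrier: limits and closures\<close>

lemma hdist_eq: "x \<in> hset H \<Longrightarrow> y \<in> hset H \<Longrightarrow> hdist H x y = nrm (x - y)"
  by (simp add: hdist_def nrm_def)

sublocale M: Metric_space "hset H" "hdist H"
proof
  fix x y z
  \<comment> \<open>The distance is 0 as soon as one argument leaves the carrier, so the two axioms
    demanded on the whole type are split by membership.\<close>
  show "0 \<le> hdist H x y"
    using nrm_nonneg[of "x - y"] hdist_eq[of x y]
    by (cases "x \<in> hset H \<and> y \<in> hset H") (auto simp: hdist_def)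
  show "hdist H x y = hdist H y x"
    using nrm_minus_commute[of x y] hdist_eq[of x y] hdist_eq[of y x]
    by (cases "x \<in> hset H \<and> y \<in> hset H") (auto simp: hdist_def)
  show "hdist H x y = 0 \<longleftrightarrow> x = y" if "x \<in> hset H" "y \<in> hset H"
    using that by (simp add: hdist_eq nrm_eq_0)
  show "hdist H x z \<le> hdist H x y + hdist H y z" if "x \<in> hset H" "y \<in> hset H" "z \<in> hset H"
    using that by (simp add: hdist_eq nrm_triangle_diff)
qed

lemma Cauchy_imp_limit:
  assumes s: "\<And>n. s n \<in> hset H"
    and Cauchy: "\<And>e. e > 0 \<Longrightarrow> \<exists>N. \<forall>m\<ge>N. \<forall>n\<ge>N. nrm (s m - s n) < e"
  obtains l where "l \<in> hset H" "(\<lambda>n. nrm (s n - l)) \<longlonglongrightarrow> 0"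
proof -
  have "M.MCauchy s"
    using Cauchy s unfolding M.MCauchy_def by (auto simp: hdist_eq)
  then obtain l where l: "limitin M.mtopology s l sequentially"
    using mcomplete unfolding M.mcomplete_def by blast
  then have lH: "l \<in> hset H" by (simp add: M.limitin_metric)
  have "(\<lambda>n. hdist H (s n) l) \<longlonglongrightarrow> 0"
    using l by (auto simp: M.limitin_metric tendsto_iff elim: eventually_mono)
  then show ?thesis using that[OF lH] s lH by (simp add: hdist_eq)
qed

text \<open>Cauchy-Schwarz bounds the error by \<open>nrm (s n - l) * nrm y\<close>, so norm
  convergence implies weak convergence.\<close>

lemma inner_tendsto:
  assumes s: "\<And>n. s n \<in> hset H" and l: "l \<in> hset H" and y: "y \<in> hset H"
    and lim: "(\<lambda>n. nrm (s n - l)) \<longlonglongrightarrow> 0"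
  shows "(\<lambda>n. hinner H (s n) y) \<longlonglongrightarrow> hinner H l y"
proof (rule LIM_zero_cancel, rule Lim_null_comparison)
  show "\<forall>\<^sub>F n in sequentially. norm (hinner H (s n) y - hinner H l y) \<le> nrm (s n - l) * nrm y"
    using s l y Cauchy_Schwarz[of "s _ - l" y] by (simp add: inner_diff_left)
  show "(\<lambda>n. nrm (s n - l) * nrm y) \<longlonglongrightarrow> 0"
    using tendsto_mult_right[OF lim, of "nrm y"] by simp
qed

lemma closure_sequence:
  assumes "h \<in> M.mtopology closure_of S"
  obtains s where "\<And>n. s n \<in> S" "\<And>n. s n \<in> hset H" "(\<lambda>n. nrm (s n - h)) \<longlonglongrightarrow> 0"
proof -
  have hH: "h \<in> hset H"
    using assms by (auto simp: M.metric_closure_of)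
  have "\<exists>y. y \<in> S \<and> y \<in> hset H \<and> nrm (y - h) < inverse (Suc n)" for n
  proof -
    have "\<forall>r>0. \<exists>y\<in>S. y \<in> M.mball h r"
      using assms unfolding M.metric_closure_of by blast
    moreover have "inverse (real (Suc n)) > 0" by simp
    ultimately obtain y where "y \<in> S" "y \<in> M.mball h (inverse (Suc n))"
      by blast
    then show ?thesis
      using nrm_minus_commute[of h y] hdist_eq[of h y] by auto
  qed
  then obtain s where s: "\<And>n. s n \<in> S" "\<And>n. s n \<in> hset H" "\<And>n. nrm (s n - h) < inverse (Suc n)"
    by metis
  have "(\<lambda>n. nrm (s n - h)) \<longlonglongrightarrow> 0"
    using LIMSEQ_inverse_real_of_nat
    by (rule tendsto_sandwich[OF _ _ tendsto_const, rotated 2])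
      (use s hH in \<open>auto intro!: always_eventually less_imp_le\<close>)
  then show ?thesis using that s by blast
qed

section \<open>Orthogonal projection onto a closed subspace\<close>

definition closed_subspace :: "'h set \<Rightarrow> bool" where
  "closed_subspace K \<longleftrightarrow> V.subspace K \<and> K \<subseteq> hset H \<and>
     (\<forall>x\<in>hset H. (\<forall>e>0. \<exists>m\<in>K. nrm (x - m) < e) \<longrightarrow> x \<in> K)"

text \<open>A nonzero inner product z with m would contradict minimality: subtracting a small
  positive multiple of z m from y shortens it, since the gain is linear in the step size and the
  cost quadratic.\<close>

lemma nearest_point_orthogonal:
  assumes K: "V.subspace K" "K \<subseteq> hset H" and y: "y \<in> hset H" and m: "m \<in> K"
    and least: "\<And>m. m \<in> K \<Longrightarrow> nrm y \<le> nrm (y - m)"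
  shows "hinner H y m = 0"
proof (rule ccontr)
  assume nz: "hinner H y m \<noteq> 0"
  have mH: "m \<in> hset H" using K m by blast
  define z where "z = hinner H y m"
  \<comment> \<open>The step size makes \<open>t * (nrm m)\<^sup>2\<close> less than 1, so the cost
    stays below the gain; the summand 1 keeps the denominator positive without a case distinction on
    m.\<close>
  define t where "t = 1 / ((nrm m)\<^sup>2 + 1)"
  have den: "(nrm m)\<^sup>2 + 1 > 0" by (smt (verit) zero_le_power2)
  have t: "t > 0" "t * (nrm m)\<^sup>2 < 1"
    using den by (auto simp: t_def field_simps)
  have zpos: "(cmod z)\<^sup>2 > 0" using nz by (simp add: z_def)
  let ?c = "of_real t * z"
  have Re: "Re (cnj ?c * z) = t * (cmod z)\<^sup>2"
    unfolding cmod_power2 by (simp add: algebra_simps power2_eq_square)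
  have "(nrm y)\<^sup>2 \<le> (nrm (y - hscale H ?c m))\<^sup>2"
    using least[of "hscale H ?c m"] K m y by (intro power_mono) (auto intro: V.subspace_scale)
  also have "\<dots> = (nrm y)\<^sup>2 - 2 * Re (cnj ?c * z) + (cmod ?c * nrm m)\<^sup>2"
    using y mH by (simp add: nrm_diff_sq inner_scale_right nrm_scale z_def)
  also have "\<dots> = (nrm y)\<^sup>2 - t * (cmod z)\<^sup>2 * (2 - t * (nrm m)\<^sup>2)"
    unfolding Re using t by (simp add: norm_mult power_mult_distrib algebra_simps power2_eq_square)
  finally have "t * (cmod z)\<^sup>2 * (2 - t * (nrm m)\<^sup>2) \<le> 0" by simp
  moreover have "t * (cmod z)\<^sup>2 * (2 - t * (nrm m)\<^sup>2) > 0"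
    using t zpos by (intro mult_pos_pos) auto
  ultimately show False by simp
qed

text \<open>Parallelogram law for x - m and x - k, whose sum is twice the difference of x and the
  midpoint of m and k.\<close>

lemma parallelogram_midpoint:
  assumes "x \<in> hset H" "m \<in> hset H" "k \<in> hset H"
  shows "(nrm (m - k))\<^sup>2 + 4 * (nrm (x - hscale H (1/2) (m + k)))\<^sup>2
     = 2 * (nrm (x - m))\<^sup>2 + 2 * (nrm (x - k))\<^sup>2"
proof -
  let ?u = "x - m" and ?v = "x - k"
  have "?u + ?v = hscale H 2 (x - hscale H (1/2) (m + k))"
  proof -
    have "hscale H 2 x = x + x" using V.scale_left_distrib[of 1 1 x] by simp
    then show ?thesis by (simp add: V.scale_right_diff_distrib)
  qed
  then have "(nrm (?u + ?v))\<^sup>2 = 4 * (nrm (x - hscale H (1/2) (m + k)))\<^sup>2"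
    using assms by (simp add: nrm_scale power_mult_distrib)
  moreover have "nrm (?u - ?v) = nrm (m - k)"
    using nrm_minus_commute[of m k] assms by simp
  ultimately show ?thesis
    using nrm_add_sq[of ?u ?v] nrm_diff_sq[of ?u ?v] assms by simp
qed

text \<open>A minimising sequence for the squared distance is Cauchy by the parallelogram law,
  because midpoints stay in K; its limit lies in K by closedness and attains the infimum.\<close>

lemma nearest_point:
  assumes K: "closed_subspace K" and x: "x \<in> hset H"
  obtains p where "p \<in> K" "\<And>m. m \<in> K \<Longrightarrow> nrm (x - p) \<le> nrm (x - m)"
proof -
  have sub: "V.subspace K" "K \<subseteq> hset H"
    and closed: "\<And>x. x \<in> hset H \<Longrightarrow> (\<And>e. e > 0 \<Longrightarrow> \<exists>m\<in>K. nrm (x - m) < e) \<Longrightarrow> x \<in> K"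
    using K by (auto simp: closed_subspace_def)
  define D where "D = (\<lambda>m. (nrm (x - m))\<^sup>2) ` K"
  define d where "d = Inf D"
  have bdd: "bdd_below D" by (auto simp: D_def intro: bdd_belowI[of _ 0])
  have ne: "D \<noteq> {}" using V.subspace_0[OF sub(1)] by (auto simp: D_def)
  have d_le: "d \<le> (nrm (x - m))\<^sup>2" if "m \<in> K" for m
    using cInf_lower[OF _ bdd] that by (auto simp: d_def D_def)
  have "\<exists>m\<in>K. (nrm (x - m))\<^sup>2 < d + inverse (Suc n)" for n
    using cInf_lessD[OF ne, of "d + inverse (Suc n)"] by (auto simp: d_def D_def)
  then obtain s where s: "\<And>n. s n \<in> K" "\<And>n. (nrm (x - s n))\<^sup>2 < d + inverse (Suc n)"
    by metis
  have sH: "s n \<in> hset H" for n using s(1) sub(2) by blast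
  \<comment> \<open>The parallelogram identity bounds the square by \<open>4 * d\<close> plus twice
    the two errors, minus four times the squared distance of the midpoint, which is at least
    \<open>d\<close>.\<close>
  have near: "(nrm (s m - s n))\<^sup>2 < 2 * inverse (Suc m) + 2 * inverse (Suc n)" for m n
  proof -
    have "d \<le> (nrm (x - hscale H (1/2) (s m + s n)))\<^sup>2"
      using s(1) sub(1) by (intro d_le V.subspace_scale V.subspace_add)
    then show ?thesis
      using parallelogram_midpoint[OF x sH[of m] sH[of n]] s(2)[of m] s(2)[of n] by linarith
  qed
  have Cauchy: "\<exists>N. \<forall>m\<ge>N. \<forall>n\<ge>N. nrm (s m - s n) < e" if "e > 0" for e
  proof -
    \<comment> \<open>With a quarter of \<open>e\<^sup>2\<close>, the two doubled errors in
      \<open>near\<close> add up to less than \<open>e\<^sup>2\<close>.\<close>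
    obtain N where N: "inverse (real (Suc N)) < e\<^sup>2 / 4"
      using reals_Archimedean[of "e\<^sup>2 / 4"] \<open>e > 0\<close>
      by (metis divide_pos_pos zero_less_numeral zero_less_power)
    have "nrm (s m - s n) < e" if "m \<ge> N" "n \<ge> N" for m n
    proof (rule power2_less_imp_less)
      have "inverse (real (Suc m)) \<le> inverse (real (Suc N))" "inverse (real (Suc n)) \<le> inverse (real (Suc N))"
        using that by (auto intro!: le_imp_inverse_le)
      then show "(nrm (s m - s n))\<^sup>2 < e\<^sup>2" using near[of m n] N by linarith
    qed (use \<open>e > 0\<close> in simp)
    then show ?thesis by blast
  qed
  obtain p where p: "p \<in> hset H" "(\<lambda>n. nrm (s n - p)) \<longlonglongrightarrow> 0"
    using Cauchy_imp_limit[OF sH Cauchy] .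
  have pK: "p \<in> K"
  proof (rule closed[OF p(1)])
    fix e :: real assume "e > 0"
    then obtain n where "nrm (s n - p) < e"
      using order_tendstoD(2)[OF p(2), of e] by (auto simp: eventually_sequentially)
    then show "\<exists>m\<in>K. nrm (p - m) < e"
      using s(1)[of n] sH[of n] p(1) nrm_minus_commute[of p "s n"]
      by (intro bexI[of _ "s n"]) simp_all
  qed
  have "nrm (x - p) \<le> nrm (x - m)" if m: "m \<in> K" for m
  proof -
    \<comment> \<open>Going from x to p through \<open>s n\<close> costs at most this bound, as
      \<open>d\<close> does not exceed the squared distance of m; in the limit only the distance
      from x to m remains.\<close>
    have "(\<lambda>n. sqrt ((nrm (x - m))\<^sup>2 + inverse (Suc n)) + nrm (s n - p))
        \<longlonglongrightarrow> sqrt ((nrm (x - m))\<^sup>2 + 0) + 0"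
      by (intro tendsto_intros p(2) LIMSEQ_inverse_real_of_nat)
    moreover have "nrm (x - p) \<le> sqrt ((nrm (x - m))\<^sup>2 + inverse (Suc n)) + nrm (s n - p)" for n
    proof -
      have "nrm (x - s n) \<le> sqrt ((nrm (x - m))\<^sup>2 + inverse (Suc n))"
        using s(2)[of n] d_le[OF m] by (intro real_le_rsqrt) linarith
      then show ?thesis using nrm_triangle_diff[OF x sH[of n] p(1)] by linarith
    qed
    ultimately have "nrm (x - p) \<le> sqrt ((nrm (x - m))\<^sup>2 + 0) + 0"
      by (intro tendsto_lowerbound[OF _ always_eventually]) auto
    moreover have "nrm (x - m) \<ge> 0" using m sub x by auto
    ultimately show ?thesis by simp
  qed
  with pK show ?thesis using that by blast
qed

text \<open>p - q lies in K and, being the difference of x - q and x - p, is orthogonal to K, hence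
  to itself.\<close>

lemma projection_unique:
  assumes K: "closed_subspace K" and x: "x \<in> hset H"
    and p: "p \<in> K" "\<forall>m\<in>K. hinner H (x - p) m = 0"
    and q: "q \<in> K" "\<forall>m\<in>K. hinner H (x - q) m = 0"
  shows "p = q"
proof -
  have sub: "V.subspace K" "K \<subseteq> hset H" using K by (auto simp: closed_subspace_def)
  then have pq: "p - q \<in> K" "p - q \<in> hset H" "p \<in> hset H" "q \<in> hset H"
    using p q by (auto intro: V.subspace_diff)
  have "hinner H (p - q) (p - q) = hinner H ((x - q) - (x - p)) (p - q)" by simp
  also have "\<dots> = hinner H (x - q) (p - q) - hinner H (x - p) (p - q)"
    by (rule inner_diff_left) (use pq x in auto)
  also have "\<dots> = 0" using p q pq by simp
  finally show ?thesis using inner_self_eq_0[of "p - q"] pq by simp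
qed

text \<open>K is stable under translation by a nearest point p, so 0 is nearest to x - p and
  \<open>nearest_point_orthogonal\<close> applies. With uniqueness this resolves the definite
  description in \<open>orth_proj\<close>.\<close>

lemma orth_proj:
  assumes K: "closed_subspace K" and x: "x \<in> hset H"
  shows orth_proj_in: "orth_proj H K x \<in> K"
    and orth_proj_orthogonal: "m \<in> K \<Longrightarrow> hinner H (x - orth_proj H K x) m = 0"
proof -
  have sub: "V.subspace K" "K \<subseteq> hset H" using K by (auto simp: closed_subspace_def)
  obtain p where p: "p \<in> K" "\<And>m. m \<in> K \<Longrightarrow> nrm (x - p) \<le> nrm (x - m)"
    using nearest_point[OF K x] by blast
  have "nrm (x - p) \<le> nrm ((x - p) - m)" if "m \<in> K" for m
    using p(2)[of "p + m"] V.subspace_add[OF sub(1) p(1) that] by (simp add: algebra_simps)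
  then have "\<forall>m\<in>K. hinner H (x - p) m = 0"
    using nearest_point_orthogonal[OF sub, of "x - p"] p(1) x sub by auto
  then have "\<exists>!p. p \<in> K \<and> (\<forall>m\<in>K. hinner H (x - p) m = 0)"
    using p(1) projection_unique[OF K x] by blast
  from theI'[OF this] show "orth_proj H K x \<in> K" "m \<in> K \<Longrightarrow> hinner H (x - orth_proj H K x) m = 0"
    unfolding orth_proj_def by auto
qed

text \<open>The difference of the projections meets the characterisation of the projection of x - y,
  so uniqueness decides. It later makes \<open>regA\<close> subtractive, as the condition on
  \<open>x n - x m\<close> in absolute continuity requires.\<close>

lemma orth_proj_diff:
  assumes K: "closed_subspace K" and xy: "x \<in> hset H" "y \<in> hset H"
  shows "orth_proj H K (x - y) = orth_proj H K x - orth_proj H K y"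
proof -
  have sub: "V.subspace K" "K \<subseteq> hset H" using K by (auto simp: closed_subspace_def)
  let ?p = "orth_proj H K x" and ?q = "orth_proj H K y"
  have pq: "?p \<in> K" "?q \<in> K" using orth_proj_in[OF K] xy by auto
  show ?thesis
  proof (rule projection_unique[OF K, of "x - y"])
    have "hinner H (x - y - (?p - ?q)) m = 0" if "m \<in> K" for m
    proof -
      have "hinner H (x - y - (?p - ?q)) m = hinner H ((x - ?p) - (y - ?q)) m"
        by (simp add: algebra_simps)
      also have "\<dots> = hinner H (x - ?p) m - hinner H (y - ?q) m"
        by (rule inner_diff_left) (use pq xy sub that in auto)
      also have "\<dots> = 0" using orth_proj_orthogonal[OF K] xy that by simp
      finally show ?thesis .
    qed
    then show "\<forall>m\<in>K. hinner H (x - y - (?p - ?q)) m = 0" by blast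
  qed (use pq sub xy orth_proj_in[OF K] orth_proj_orthogonal[OF K] in \<open>auto intro: V.subspace_diff\<close>)
qed

text \<open>Since x - p is orthogonal to p, replacing the second argument x by x - p changes
  nothing.\<close>

lemma inner_orth_proj_self:
  assumes K: "closed_subspace K" and x: "x \<in> hset H"
  shows "hinner H (x - orth_proj H K x) x = of_real ((nrm (x - orth_proj H K x))\<^sup>2)"
proof -
  let ?p = "orth_proj H K x"
  have p: "?p \<in> K" "?p \<in> hset H"
    using orth_proj_in[OF K x] K by (auto simp: closed_subspace_def)
  have "hinner H (x - ?p) (x - ?p) = hinner H (x - ?p) x - hinner H (x - ?p) ?p"
    by (rule inner_diff_right) (use p x in auto)
  then show ?thesis
    using p x orth_proj_orthogonal[OF K x p(1)] by (simp add: inner_self)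
qed

end

section \<open>Closures in a product of two carrier spaces\<close>

locale hilbert_carrier_pair = HA: hilbert_carrier HA + HB: hilbert_carrier HB
  for HA :: "('h::ab_group_add, 'm) hilbert_scheme"
    and HB :: "('k::ab_group_add, 'n) hilbert_scheme"

text \<open>Products of balls form a neighbourhood base of the product topology, and the smaller of
  two radii serves both factors.\<close>

lemma (in hilbert_carrier_pair) in_prod_closure_iff:
  assumes S: "S \<subseteq> hset HA \<times> hset HB"
  shows "(u, v) \<in> prod_topology (htopology HA) (htopology HB) closure_of S \<longleftrightarrow>
    u \<in> hset HA \<and> v \<in> hset HB \<and>
    (\<forall>e>0. \<exists>(a, b)\<in>S. HA.nrm (u - a) < e \<and> HB.nrm (v - b) < e)"
    (is "?L \<longleftrightarrow> ?R")
proof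
  assume L: ?L
  then have uv: "u \<in> hset HA" "v \<in> hset HB"
    by (auto simp: in_closure_of)
  have "\<exists>(a, b)\<in>S. HA.nrm (u - a) < e \<and> HB.nrm (v - b) < e" if e: "e > 0" for e
  proof -
    have "openin (prod_topology (htopology HA) (htopology HB)) (HA.M.mball u e \<times> HB.M.mball v e)"
      by (simp add: openin_prod_Times_iff)
    moreover have "(u, v) \<in> HA.M.mball u e \<times> HB.M.mball v e"
      using uv e by simp
    ultimately have "\<exists>p. p \<in> S \<and> p \<in> HA.M.mball u e \<times> HB.M.mball v e"
      by (intro L[unfolded in_closure_of, THEN conjunct2, rule_format] conjI)
    then obtain a b where "(a, b) \<in> S" "a \<in> HA.M.mball u e" "b \<in> HB.M.mball v e"
      by blast
    then show ?thesis
      using HA.hdist_eq[of u a] HB.hdist_eq[of v b] by (intro bexI[of _ "(a, b)"]) simp_all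
  qed
  then show ?R using uv by blast
next
  assume R: ?R
  have "\<exists>p. p \<in> S \<and> p \<in> W"
    if W: "(u, v) \<in> W" "openin (prod_topology (htopology HA) (htopology HB)) W" for W
  proof -
    obtain U V where UV: "openin (htopology HA) U" "openin (htopology HB) V" "u \<in> U" "v \<in> V" "U \<times> V \<subseteq> W"
      using W unfolding openin_prod_topology_alt by meson
    obtain r s where rs: "r > 0" "HA.M.mball u r \<subseteq> U" "s > 0" "HB.M.mball v s \<subseteq> V"
      using UV unfolding HA.M.openin_mtopology HB.M.openin_mtopology by meson
    have "min r s > 0" using rs by simp
    then obtain a b where ab: "(a, b) \<in> S" "HA.nrm (u - a) < min r s" "HB.nrm (v - b) < min r s"
      using R by blast
    then have "a \<in> HA.M.mball u r" "b \<in> HB.M.mball v s"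
      using R S by (auto simp: HA.hdist_eq HB.hdist_eq)
    then show ?thesis using ab(1) rs UV by blast
  qed
  then show ?L using R by (simp add: in_closure_of)
qed

section \<open>Weak topologies\<close>

text \<open>A member of the family pulls the whole plane back to everything, whereas the topology
  generated by no sets has empty carrier.\<close>

lemma topspace_weak_topology [simp]: "\<Phi> \<noteq> {} \<Longrightarrow> topspace (weak_topology \<Phi>) = UNIV"
  unfolding weak_topology_def topology_generated_by_topspace
  using open_UNIV by blast

lemma openin_weak_topology_vimage:
  "\<phi> \<in> \<Phi> \<Longrightarrow> open U \<Longrightarrow> openin (weak_topology \<Phi>) (\<phi> -` U)"
  unfolding weak_topology_def by (rule topology_generated_by_Basis) blast

text \<open>Forward, test the limit on subbasic preimages. Backward, being eventually in every
  neighbourhood of l survives finite intersections and unions, so induction over generated open sets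
  reduces to subbasic ones.\<close>

lemma limitin_weak_topology_iff:
  assumes ne: "\<Phi> \<noteq> {}"
  shows "limitin (weak_topology \<Phi>) s l F \<longleftrightarrow> (\<forall>\<phi>\<in>\<Phi>. ((\<lambda>n. \<phi> (s n)) \<longlongrightarrow> \<phi> l) F)"
    (is "?L \<longleftrightarrow> ?R")
proof
  assume L: ?L
  show ?R
  proof (intro ballI topological_tendstoI)
    fix \<phi> U assume "\<phi> \<in> \<Phi>" "open U" "\<phi> l \<in> U"
    then show "\<forall>\<^sub>F n in F. \<phi> (s n) \<in> U"
      using L openin_weak_topology_vimage[of \<phi> \<Phi> U] unfolding limitin_def by auto
  qed
next
  assume R: ?R
  have "\<forall>\<^sub>F n in F. s n \<in> U" if "openin (weak_topology \<Phi>) U" "l \<in> U" for U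
    using that unfolding weak_topology_def openin_topology_generated_by_iff
  proof (induction rule: generate_topology_on.induct)
    case (Int a b)
    then show ?case by (simp add: eventually_conj)
  next
    case (UN K)
    then obtain k where "k \<in> K" "\<forall>\<^sub>F n in F. s n \<in> k" by blast
    then show ?case by (auto elim: eventually_mono)
  next
    case (Basis V)
    then obtain \<phi> U where \<phi>: "V = \<phi> -` U" "\<phi> \<in> \<Phi>" "open U" by blast
    then show ?case using R Basis topological_tendstoD[of "\<lambda>n. \<phi> (s n)" "\<phi> l" F U] by simp
  qed simp
  then show ?L using ne by (simp add: limitin_def)
qed

text \<open>Induction over generated neighbourhoods of 0: intersections take the larger index, a
  union uses the member containing 0, and a subbasic set reduces to a disc about 0 because the
  functionals respect differences.\<close>

lemma tvs_Cauchy_weak_topologyI: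
  assumes diff: "\<And>\<phi> x y. \<phi> \<in> \<Phi> \<Longrightarrow> \<phi> (x - y) = \<phi> x - \<phi> y"
    and Cauchy: "\<And>\<phi>. \<phi> \<in> \<Phi> \<Longrightarrow> Cauchy (\<lambda>n. \<phi> (s n))"
  shows "tvs_Cauchy (weak_topology \<Phi>) s"
proof -
  have "\<exists>N. \<forall>m\<ge>N. \<forall>n\<ge>N. s m - s n \<in> U" if "openin (weak_topology \<Phi>) U" "0 \<in> U" for U
    using that unfolding weak_topology_def openin_topology_generated_by_iff
  proof (induction rule: generate_topology_on.induct)
    case (Int a b)
    then obtain M N where "\<forall>m\<ge>M. \<forall>n\<ge>M. s m - s n \<in> a" "\<forall>m\<ge>N. \<forall>n\<ge>N. s m - s n \<in> b"
      by auto
    then show ?case by (intro exI[of _ "max M N"]) auto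
  next
    case (UN K)
    then show ?case by (meson UnionE UnionI)
  next
    case (Basis V)
    then obtain \<phi> U where \<phi>: "V = \<phi> -` U" "\<phi> \<in> \<Phi>" "open U" by blast
    have "\<phi> 0 = 0" using diff[OF \<phi>(2), of 0 0] by simp
    then have "0 \<in> U" using Basis \<phi> by simp
    then obtain e where e: "e > 0" "ball 0 e \<subseteq> U"
      using \<phi>(3) by (meson openE)
    obtain N where N: "\<forall>m\<ge>N. \<forall>n\<ge>N. norm (\<phi> (s m) - \<phi> (s n)) < e"
      using Cauchy[OF \<phi>(2)] e(1) unfolding Cauchy_iff by blast
    have "s m - s n \<in> V" if "m \<ge> N" "n \<ge> N" for m n
    proof -
      have "\<phi> (s m - s n) \<in> ball 0 e" using N that \<phi>(2) by (simp add: diff)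
      then show ?thesis using e \<phi> by blast
    qed
    then show ?case by blast
  qed simp
  then show ?thesis by (simp add: tvs_Cauchy_def)
qed

section \<open>The operators attached to a completion\<close>

context anti_dual_pair
begin

lemma pairing_diff_left: "pairing (f - g) x = pairing f x - pairing g x"
  using pairing_add_left[of "f - g" g x] by (simp add: algebra_simps)

lemma pairing_eqI: "(\<And>x. pairing f x = pairing g x) \<Longrightarrow> f = g"
  using separates_left[of "f - g"] by (simp add: pairing_diff_left)

text \<open>Pointwise convergence makes the sequence Cauchy for \<open>sigma_FE\<close>, so
  sequential completeness realises the limit functional by an element of F. This is where
  completeness of the pair enters.\<close>

lemma weak_star_limit:
  assumes "weak_star_sequentially_complete pairing"
    and "\<And>x. convergent (\<lambda>n. pairing (s n) x)"
  obtains l where "\<And>x. (\<lambda>n. pairing (s n) x) \<longlonglongrightarrow> pairing l x"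
proof -
  have "tvs_Cauchy (sigma_FE pairing) s"
    unfolding sigma_FE_def
    by (rule tvs_Cauchy_weak_topologyI)
      (use assms(2) in \<open>auto simp: pairing_diff_left intro: convergent_Cauchy\<close>)
  then obtain l where "limitin (sigma_FE pairing) s l sequentially"
    using assms(1) unfolding weak_star_sequentially_complete_def by blast
  then have "(\<lambda>n. pairing (s n) x) \<longlonglongrightarrow> pairing l x" for x
    unfolding sigma_FE_def by (subst (asm) limitin_weak_topology_iff) auto
  then show ?thesis using that by blast
qed

end

locale positive_completion =
  anti_dual_pair scaleE scaleF pairing + H: hilbert_carrier HA
  for scaleE :: "complex \<Rightarrow> 'e::ab_group_add \<Rightarrow> 'e"
    and scaleF :: "complex \<Rightarrow> 'f::ab_group_add \<Rightarrow> 'f"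
    and pairing :: "'f \<Rightarrow> 'e \<Rightarrow> complex"
    and A :: "'e \<Rightarrow> 'f"
    and HA :: "('f, 'h::ab_group_add) completion" +
  assumes complete: "weak_star_sequentially_complete pairing"
    and linear: "Vector_Spaces.linear scaleE scaleF A"
    and completion: "hilbert_completion scaleF pairing A HA"
begin

text \<open>The vector Ax of the auxiliary space; \<open>J_adj_eq\<close> identifies this map with
  the adjoint of J_A.\<close>

abbreviation canon :: "'e \<Rightarrow> 'h" where
  "canon x \<equiv> emb HA (A x)"

lemma canon_in [simp]: "canon x \<in> hset HA"
  and inner_canon: "hinner HA (canon x) (canon y) = pairing (A x) y"
  and dense: "htopology HA closure_of (emb HA ` range A) = hset HA"
  and emb_linear: "linear_on (range A) scaleF (hscale HA) (emb HA)"
  using completion by (auto simp: hilbert_completion_def)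

lemma A_add: "A (x + y) = A x + A y" and A_scale: "A (scaleE c x) = scaleF c (A x)"
  using linear by (simp_all add: Vector_Spaces.linear_iff)

lemma canon_add: "canon (x + y) = canon x + canon y"
  using emb_linear by (simp add: linear_on_def A_add)

lemma canon_scale: "canon (scaleE c x) = hscale HA c (canon x)"
  using emb_linear by (simp add: linear_on_def A_scale)

lemma canon_diff: "canon (x - y) = canon x - canon y"
  using canon_add[of "x - y" y] by (simp add: algebra_simps)

lemma approximating_sequence:
  assumes "h \<in> hset HA"
  obtains y where "(\<lambda>n. H.nrm (canon (y n) - h)) \<longlonglongrightarrow> 0"
proof -
  have "h \<in> htopology HA closure_of (emb HA ` range A)"
    using assms dense by simp
  then obtain s where s: "\<And>n. s n \<in> emb HA ` range A" "\<And>n. s n \<in> hset HA"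
      "(\<lambda>n. H.nrm (s n - h)) \<longlonglongrightarrow> 0"
    by (rule H.closure_sequence) blast
  have "\<exists>y. s n = canon y" for n using s(1)[of n] by blast
  then obtain y where "\<And>n. s n = canon (y n)" by metis
  then show ?thesis using that[of y] s(3) by simp
qed

text \<open>The functional is the pointwise limit of those given by \<open>A (y n)\<close>, where
  the vectors \<open>canon (y n)\<close> tend to h; completeness represents it in F, by the future
  value of J_A at h.\<close>

lemma ex_representing:
  assumes h: "h \<in> hset HA"
  shows "\<exists>f. \<forall>x. pairing f x = hinner HA h (canon x)"
proof -
  obtain y where y: "(\<lambda>n. H.nrm (canon (y n) - h)) \<longlonglongrightarrow> 0"
    using approximating_sequence[OF h] by blast
  have lim: "(\<lambda>n. pairing (A (y n)) x) \<longlonglongrightarrow> hinner HA h (canon x)" for x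
    using H.inner_tendsto[OF _ h _ y, of "canon x"] by (simp add: inner_canon)
  then have "convergent (\<lambda>n. pairing (A (y n)) x)" for x
    unfolding convergent_def by blast
  then obtain f where "\<And>x. (\<lambda>n. pairing (A (y n)) x) \<longlonglongrightarrow> pairing f x"
    by (rule weak_star_limit[OF complete]) blast
  then show ?thesis using lim LIMSEQ_unique by blast
qed

lemma topspace_hweak_topology [simp]: "topspace (hweak_topology HA) = hset HA"
  unfolding hweak_topology_def topspace_subtopology
  by (subst topspace_weak_topology) (auto intro: H.hset_zero)

text \<open>Vectors from the embedded range that approximate h in norm also do so weakly. Continuity
  of J carries this to F, where their images are the \<open>A (y n)\<close> themselves, and limits
  of scalars are unique.\<close>

lemma weakly_continuous_extension_unique:
  assumes cont: "continuous_map (hweak_topology HA) (sigma_FE pairing) J"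
    and J: "\<forall>f\<in>range A. J (emb HA f) = f" and h: "h \<in> hset HA"
  shows "pairing (J h) x = hinner HA h (canon x)"
proof -
  obtain y where y: "(\<lambda>n. H.nrm (canon (y n) - h)) \<longlonglongrightarrow> 0"
    using approximating_sequence[OF h] by blast
  have "limitin (hweak_topology HA) (\<lambda>n. canon (y n)) h sequentially"
    unfolding hweak_topology_def limitin_subtopology
    by (subst limitin_weak_topology_iff)
      (use h y H.inner_tendsto H.hset_zero in \<open>auto intro!: H.inner_tendsto\<close>)
  from continuous_map_limit[OF cont this]
  have "limitin (sigma_FE pairing) (\<lambda>n. A (y n)) (J h) sequentially"
    using J by (simp add: o_def)
  then have "(\<lambda>n. pairing (A (y n)) x) \<longlonglongrightarrow> pairing (J h) x"
    unfolding sigma_FE_def by (subst (asm) limitin_weak_topology_iff) auto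
  moreover have "(\<lambda>n. pairing (A (y n)) x) \<longlonglongrightarrow> hinner HA h (canon x)"
    using H.inner_tendsto[OF _ h _ y, of "canon x"] by (simp add: inner_canon)
  ultimately show ?thesis by (rule LIMSEQ_unique)
qed

text \<open>The definite description is resolved by exhibiting a map: J sends h to a chosen
  representative from \<open>ex_representing\<close>. It has all required properties, and
  \<open>weakly_continuous_extension_unique\<close> forces any competitor to agree with it.\<close>

lemma pairing_J_op:
  assumes h: "h \<in> hset HA"
  shows "pairing (J_op scaleF pairing A HA h) x = hinner HA h (canon x)"
proof -
  define P where "P J \<longleftrightarrow> J \<in> extensional (hset HA) \<and>
      linear_on (hset HA) (hscale HA) scaleF J \<and>
      continuous_map (hweak_topology HA) (sigma_FE pairing) J \<and>
      (\<forall>f\<in>range A. J (emb HA f) = f)" for J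
  define J where "J = restrict (\<lambda>h. SOME f. \<forall>x. pairing f x = hinner HA h (canon x)) (hset HA)"
  have J: "pairing (J h) x = hinner HA h (canon x)" if "h \<in> hset HA" for h x
    using someI_ex[OF ex_representing[OF that]] that by (simp add: J_def)
  have "linear_on (hset HA) (hscale HA) scaleF J"
    unfolding linear_on_def
    by (auto intro!: pairing_eqI simp: J pairing_add_left pairing_scale_left
        H.inner_add_left H.inner_scale_left)
  moreover have "continuous_map (hweak_topology HA) (sigma_FE pairing) J"
    unfolding sigma_FE_def weak_topology_def
  proof (rule continuous_on_generated_topo)
    fix V assume "V \<in> {\<phi> -` U |\<phi> U. \<phi> \<in> {(\<lambda>f. pairing f x) |x. True} \<and> open U}"
    then obtain x U where V: "V = (\<lambda>f. pairing f x) -` U" "open U" by blast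
    \<comment> \<open>A subbasic set belonging to x pulls back under J to the subbasic set of the
      functional with representing vector \<open>canon x\<close>.\<close>
    have "J -` V \<inter> hset HA = (\<lambda>h. hinner HA h (canon x)) -` U \<inter> hset HA"
      using V by (auto simp: J)
    moreover have "openin (weak_topology {\<lambda>h. hinner HA h k |k. k \<in> hset HA})
        ((\<lambda>h. hinner HA h (canon x)) -` U)"
      using V(2) by (intro openin_weak_topology_vimage) auto
    ultimately show "openin (hweak_topology HA) (J -` V \<inter> topspace (hweak_topology HA))"
      unfolding topspace_hweak_topology by (auto simp: hweak_topology_def openin_subtopology)
  next
    show "J ` topspace (hweak_topology HA)
        \<subseteq> \<Union> {\<phi> -` U |\<phi> U. \<phi> \<in> {(\<lambda>f. pairing f x) |x. True} \<and> open U}"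
      using open_UNIV by blast
  qed
  moreover have "\<forall>f\<in>range A. J (emb HA f) = f"
    by (auto intro!: pairing_eqI simp: J inner_canon)
  ultimately have PJ: "P J" unfolding P_def J_def by blast
  \<comment> \<open>On the carrier the pairing separates values; off it both maps are fixed by
    extensionality.\<close>
  have "K = J" if "P K" for K
  proof (rule extensionalityI[of _ "hset HA"])
    show "K h = J h" if "h \<in> hset HA" for h
    proof (rule pairing_eqI)
      show "pairing (K h) x = pairing (J h) x" for x
        using \<open>P K\<close> weakly_continuous_extension_unique[of K h x] that J by (simp add: P_def)
    qed
  qed (use that PJ in \<open>auto simp: P_def\<close>)
  with PJ have "(THE J. P J) = J" by (rule the_equality)
  then have "J_op scaleF pairing A HA = J"
    by (simp add: J_op_def P_def)
  then show ?thesis using J[OF h] by simp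
qed

text \<open>Any candidate T has the same inner products as \<open>canon\<close> against every
  carrier vector; testing with their difference shows that the difference vanishes.\<close>

lemma J_adj_eq: "J_adj scaleF pairing A HA = canon"
  unfolding J_adj_def
proof (rule the_equality)
  fix T
  assume T: "(\<forall>x. T x \<in> hset HA) \<and>
    (\<forall>h\<in>hset HA. \<forall>x. pairing (J_op scaleF pairing A HA h) x = hinner HA h (T x))"
  show "T = canon"
  proof
    fix x
    have d: "T x - canon x \<in> hset HA" using T by simp
    have "hinner HA (T x - canon x) (T x) = hinner HA (T x - canon x) (canon x)"
      using T d pairing_J_op[OF d, of x] by metis
    then have "hinner HA (T x - canon x) (T x - canon x) = 0"
      using T d by (simp add: H.inner_diff_right)
    then show "T x = canon x" using H.inner_self_eq_0[OF d] by simp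
  qed
qed (auto simp: pairing_J_op)

text \<open>By \<open>pairing_J_op\<close> the pairing becomes the inner product of the
  projected-out vector with \<open>canon x\<close>, which \<open>inner_orth_proj_self\<close> makes
  a squared norm.\<close>

lemma pairing_compressed:
  assumes K: "H.closed_subspace K"
  shows "pairing (J_op scaleF pairing A HA (canon x - orth_proj HA K (canon x))) x
    = of_real ((H.nrm (canon x - orth_proj HA K (canon x)))\<^sup>2)"
proof -
  have "orth_proj HA K (canon x) \<in> hset HA"
    using H.orth_proj_in[OF K] K by (auto simp: H.closed_subspace_def)
  then show ?thesis
    using H.inner_orth_proj_self[OF K, of "canon x"] by (simp add: pairing_J_op)
qed

end

section \<open>The closure of the joint graph\<close>

locale positive_pair =
  A: positive_completion scaleE scaleF pairing A HA +
  B: positive_completion scaleE scaleF pairing B HB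
  for scaleE :: "complex \<Rightarrow> 'e::ab_group_add \<Rightarrow> 'e"
    and scaleF :: "complex \<Rightarrow> 'f::ab_group_add \<Rightarrow> 'f"
    and pairing :: "'f \<Rightarrow> 'e \<Rightarrow> complex"
    and A B :: "'e \<Rightarrow> 'f"
    and HA :: "('f, 'h::ab_group_add) completion"
    and HB :: "('f, 'k::ab_group_add) completion"
begin

text \<open>The closed relation T, kept symmetric in the two factors so that one object yields both
  multivalued parts.\<close>

definition graph_closure :: "'h \<Rightarrow> 'k \<Rightarrow> bool" where
  "graph_closure u v \<longleftrightarrow> u \<in> hset HA \<and> v \<in> hset HB \<and>
     (\<forall>e>0. \<exists>x. A.H.nrm (u - A.canon x) < e \<and> B.H.nrm (v - B.canon x) < e)"

lemma graph_closure_canon: "graph_closure (A.canon x) (B.canon x)"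
  unfolding graph_closure_def by (auto intro!: exI[of _ x])

lemma graph_closure_add:
  assumes "graph_closure u v" "graph_closure u' v'"
  shows "graph_closure (u + u') (v + v')"
proof -
  have mem: "u \<in> hset HA" "v \<in> hset HB" "u' \<in> hset HA" "v' \<in> hset HB"
    using assms by (auto simp: graph_closure_def)
  have "\<exists>x. A.H.nrm (u + u' - A.canon x) < e \<and> B.H.nrm (v + v' - B.canon x) < e" if e: "e > 0" for e
  proof -
    have "e / 2 > 0" using e by simp
    then obtain x y where
      "A.H.nrm (u - A.canon x) < e / 2" "B.H.nrm (v - B.canon x) < e / 2"
      "A.H.nrm (u' - A.canon y) < e / 2" "B.H.nrm (v' - B.canon y) < e / 2"
      using assms unfolding graph_closure_def by meson
    moreover have eq: "u + u' - A.canon (x + y) = (u - A.canon x) + (u' - A.canon y)"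
      "v + v' - B.canon (x + y) = (v - B.canon x) + (v' - B.canon y)"
      by (simp_all add: A.canon_add B.canon_add)
    ultimately have "A.H.nrm (u + u' - A.canon (x + y)) < e \<and> B.H.nrm (v + v' - B.canon (x + y)) < e"
      unfolding eq
      using A.H.nrm_triangle[of "u - A.canon x" "u' - A.canon y"]
        B.H.nrm_triangle[of "v - B.canon x" "v' - B.canon y"] mem by simp
    then show ?thesis by blast
  qed
  then show ?thesis using mem by (simp add: graph_closure_def)
qed

lemma graph_closure_scale:
  assumes "graph_closure u v"
  shows "graph_closure (hscale HA c u) (hscale HB c v)"
proof -
  have mem: "u \<in> hset HA" "v \<in> hset HB" using assms by (auto simp: graph_closure_def)
  have "\<exists>x. A.H.nrm (hscale HA c u - A.canon x) < e \<and> B.H.nrm (hscale HB c v - B.canon x) < e"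
    if e: "e > 0" for e
  proof -
    \<comment> \<open>The summand 1 allows division by k even when c is 0.\<close>
    define k where "k = cmod c + 1"
    have k: "k > 0" "cmod c < k" by (auto simp: k_def add_nonneg_pos)
    then obtain x where x: "A.H.nrm (u - A.canon x) < e / k" "B.H.nrm (v - B.canon x) < e / k"
      using assms e unfolding graph_closure_def by (meson divide_pos_pos)
    have small: "cmod c * r < e" if "0 \<le> r" "r < e / k" for r
    proof -
      have "cmod c * r \<le> k * r" using k that by (intro mult_right_mono) auto
      also have "\<dots> < e" using k that by (simp add: field_simps)
      finally show ?thesis .
    qed
    have "A.H.nrm (hscale HA c (u - A.canon x)) < e" "B.H.nrm (hscale HB c (v - B.canon x)) < e"
      using x mem small by (simp_all add: A.H.nrm_scale B.H.nrm_scale)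
    then show ?thesis
      by (auto intro!: exI[of _ "scaleE c x"]
          simp: A.canon_scale B.canon_scale A.H.V.scale_right_diff_distrib B.H.V.scale_right_diff_distrib)
  qed
  then show ?thesis using mem by (simp add: graph_closure_def)
qed

lemma graph_closure_zero: "graph_closure 0 0"
  using graph_closure_canon[of 0] graph_closure_scale[of "A.canon 0" "B.canon 0" 0] by simp

lemma graph_closure_diff: "graph_closure u v \<Longrightarrow> graph_closure u' v' \<Longrightarrow> graph_closure (u - u') (v - v')"
  using graph_closure_add[of u v "- u'" "- v'"] graph_closure_scale[of u' v' "- 1"] by simp

text \<open>Closures are idempotent: half of the tolerance goes to a pair in the relation, half to a
  graph point near that pair.\<close>

lemma graph_closure_limit:
  assumes mem: "u \<in> hset HA" "v \<in> hset HB"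
    and approx: "\<And>e. e > 0 \<Longrightarrow> \<exists>a b. graph_closure a b \<and> A.H.nrm (u - a) < e \<and> B.H.nrm (v - b) < e"
  shows "graph_closure u v"
proof -
  have "\<exists>x. A.H.nrm (u - A.canon x) < e \<and> B.H.nrm (v - B.canon x) < e" if e: "e > 0" for e
  proof -
    have e2: "e / 2 > 0" using e by simp
    then obtain a b where ab: "graph_closure a b" "A.H.nrm (u - a) < e / 2" "B.H.nrm (v - b) < e / 2"
      using approx by blast
    obtain x where x: "A.H.nrm (a - A.canon x) < e / 2" "B.H.nrm (b - B.canon x) < e / 2"
      using ab(1) e2 unfolding graph_closure_def by blast
    have "a \<in> hset HA" "b \<in> hset HB" using ab(1) by (auto simp: graph_closure_def)
    then have "A.H.nrm (u - A.canon x) < e \<and> B.H.nrm (v - B.canon x) < e"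
      using A.H.nrm_triangle_diff[OF mem(1), of a "A.canon x"]
        B.H.nrm_triangle_diff[OF mem(2), of b "B.canon x"] ab x by simp
    then show ?thesis by blast
  qed
  then show ?thesis using mem by (simp add: graph_closure_def)
qed

section \<open>The two multivalued parts as sections of the relation\<close>

lemma multivalued_part_eq: "multivalued_part A HA B HB = {\<xi>. graph_closure 0 \<xi>}"
proof -
  interpret hilbert_carrier_pair HA HB ..
  have S: "{(A.canon x, B.canon x) |x. True} \<subseteq> hset HA \<times> hset HB" by auto
  show ?thesis
    unfolding multivalued_part_def in_prod_closure_iff[OF S] graph_closure_def by fastforce
qed

text \<open>Exchanging A and B flips the pairs, so the multivalued part of the flipped closure is
  the kernel of the original one.\<close>

lemma multivalued_part_swap_eq: "multivalued_part B HB A HA = {\<zeta>. graph_closure \<zeta> 0}"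
proof -
  interpret hilbert_carrier_pair HB HA ..
  have S: "{(B.canon x, A.canon x) |x. True} \<subseteq> hset HB \<times> hset HA" by auto
  show ?thesis
    unfolding multivalued_part_def in_prod_closure_iff[OF S] graph_closure_def by fastforce
qed

text \<open>A section of a closed linear relation over 0: approximants (0, m) of (0, v) carry no
  error in \<open>HA\<close>, so \<open>graph_closure_limit\<close> applies.\<close>

lemma closed_subspace_multivalued_part: "B.H.closed_subspace (multivalued_part A HA B HB)"
  unfolding B.H.closed_subspace_def multivalued_part_eq
proof (intro conjI ballI impI)
  show "B.H.V.subspace {\<xi>. graph_closure 0 \<xi>}"
    using graph_closure_zero graph_closure_add[of 0 _ 0] graph_closure_scale[of 0]
    by (intro B.H.V.subspaceI) auto
  fix v assume v: "v \<in> hset HB" "\<forall>e>0. \<exists>m\<in>{\<xi>. graph_closure 0 \<xi>}. B.H.nrm (v - m) < e"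
  have "graph_closure 0 v"
  proof (rule graph_closure_limit)
    fix e :: real assume "e > 0"
    then obtain m where "graph_closure 0 m" "B.H.nrm (v - m) < e" using v(2) by blast
    then show "\<exists>a b. graph_closure a b \<and> A.H.nrm (0 - a) < e \<and> B.H.nrm (v - b) < e"
      using \<open>e > 0\<close> by (intro exI[of _ 0] exI[of _ m]) simp
  qed (use v in auto)
  then show "v \<in> {\<xi>. graph_closure 0 \<xi>}" by simp
qed (auto simp: graph_closure_def)

lemma closed_subspace_multivalued_part_swap: "A.H.closed_subspace (multivalued_part B HB A HA)"
  unfolding A.H.closed_subspace_def multivalued_part_swap_eq
proof (intro conjI ballI impI)
  show "A.H.V.subspace {\<zeta>. graph_closure \<zeta> 0}"
    using graph_closure_zero graph_closure_add[of _ 0 _ 0] graph_closure_scale[of _ 0]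
    by (intro A.H.V.subspaceI) auto
  fix u assume u: "u \<in> hset HA" "\<forall>e>0. \<exists>m\<in>{\<zeta>. graph_closure \<zeta> 0}. A.H.nrm (u - m) < e"
  have "graph_closure u 0"
  proof (rule graph_closure_limit)
    fix e :: real assume "e > 0"
    then obtain m where "graph_closure m 0" "A.H.nrm (u - m) < e" using u(2) by blast
    then show "\<exists>a b. graph_closure a b \<and> A.H.nrm (u - a) < e \<and> B.H.nrm (0 - b) < e"
      using \<open>e > 0\<close> by (intro exI[of _ m] exI[of _ 0]) simp
  qed (use u in auto)
  then show "u \<in> {\<zeta>. graph_closure \<zeta> 0}" by simp
qed (auto simp: graph_closure_def)

section \<open>Regular parts and their quadratic forms\<close>

definition regA :: "'e \<Rightarrow> 'h" where
  "regA x = A.canon x - orth_proj HA (multivalued_part B HB A HA) (A.canon x)"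

definition regB :: "'e \<Rightarrow> 'k" where
  "regB x = B.canon x - orth_proj HB (multivalued_part A HA B HB) (B.canon x)"

text \<open>With this, conditions on the quadratic form of A_a become norm conditions on the vectors
  (I - Q)Ax in \<open>HA\<close>.\<close>

lemma pairing_ac_part_A:
  "pairing (ac_part scaleF pairing B HB A HA x) x = of_real ((A.H.nrm (regA x))\<^sup>2)"
  using A.pairing_compressed[OF closed_subspace_multivalued_part_swap]
  by (simp add: ac_part_def A.J_adj_eq regA_def Let_def)

lemma pairing_ac_part_B:
  "pairing (ac_part scaleF pairing A HA B HB x) x = of_real ((B.H.nrm (regB x))\<^sup>2)"
  using B.pairing_compressed[OF closed_subspace_multivalued_part]
  by (simp add: ac_part_def B.J_adj_eq regB_def Let_def)

lemma regA_diff: "regA (x - y) = regA x - regA y"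
  using A.H.orth_proj_diff[OF closed_subspace_multivalued_part_swap, of "A.canon x" "A.canon y"]
  by (simp add: regA_def A.canon_diff)

lemma regA_orthogonal: "graph_closure \<zeta> 0 \<Longrightarrow> hinner HA (regA x) \<zeta> = 0"
  using A.H.orth_proj_orthogonal[OF closed_subspace_multivalued_part_swap, of "A.canon x" \<zeta>]
  by (simp add: regA_def multivalued_part_swap_eq)

text \<open>The range of Q is the kernel of the relation and the range of P its multivalued part, so
  both corrections can be subtracted inside the linear relation.\<close>

lemma graph_closure_reg: "graph_closure (regA x) (regB x)"
proof -
  have "graph_closure (orth_proj HA (multivalued_part B HB A HA) (A.canon x)) 0"
    using A.H.orth_proj_in[OF closed_subspace_multivalued_part_swap, of "A.canon x"]
    by (simp add: multivalued_part_swap_eq)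
  moreover have "graph_closure 0 (orth_proj HB (multivalued_part A HA B HB) (B.canon x))"
    using B.H.orth_proj_in[OF closed_subspace_multivalued_part, of "B.canon x"]
    by (simp add: multivalued_part_eq)
  ultimately show ?thesis
    using graph_closure_diff[OF graph_closure_diff[OF graph_closure_canon[of x]]]
    unfolding regA_def regB_def by fastforce
qed

lemma abs_continuous_ac_parts:
  "abs_continuous pairing (ac_part scaleF pairing B HB A HA) (ac_part scaleF pairing A HA B HB)"
  unfolding abs_continuous_def pairing_ac_part_A pairing_ac_part_B
proof (intro allI impI)
  fix x :: "nat \<Rightarrow> 'e"
  assume B0: "(\<lambda>n. complex_of_real ((B.H.nrm (regB (x n)))\<^sup>2)) \<longlonglongrightarrow> 0"
    and AC: "((\<lambda>(n, m). complex_of_real ((A.H.nrm (regA (x n - x m)))\<^sup>2)) \<longlongrightarrow> 0)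
      (sequentially \<times>\<^sub>F sequentially)"
  have mem: "regA y \<in> hset HA" "regB y \<in> hset HB" for y
    using graph_closure_reg[of y] by (auto simp: graph_closure_def)
  have "(\<lambda>n. (B.H.nrm (regB (x n)))\<^sup>2) \<longlonglongrightarrow> 0"
    using tendsto_Re[OF B0] by (simp del: of_real_power)
  then have "(\<lambda>n. sqrt ((B.H.nrm (regB (x n)))\<^sup>2)) \<longlonglongrightarrow> sqrt 0"
    by (rule tendsto_real_sqrt)
  then have B_lim: "(\<lambda>n. B.H.nrm (regB (x n))) \<longlonglongrightarrow> 0"
    using mem by simp
  have "\<exists>N. \<forall>m\<ge>N. \<forall>n\<ge>N. A.H.nrm (regA (x m) - regA (x n)) < e" if e: "e > 0" for e
  proof -
    \<comment> \<open>The hypothesis controls squared norms, hence the tolerance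
      \<open>e\<^sup>2\<close>; the product filter gives one N for both indices.\<close>
    have "\<forall>\<^sub>F p in sequentially \<times>\<^sub>F sequentially.
        (A.H.nrm (regA (x (fst p) - x (snd p))))\<^sup>2 < e\<^sup>2"
      using tendstoD[OF AC, of "e\<^sup>2"] e by (simp add: case_prod_beta norm_power)
    then obtain N where "\<forall>m\<ge>N. \<forall>n\<ge>N. (A.H.nrm (regA (x n - x m)))\<^sup>2 < e\<^sup>2"
      unfolding eventually_prod_sequentially by auto
    then show ?thesis
      using e by (auto simp: regA_diff intro!: exI[of _ N] power2_less_imp_less[of _ e])
  qed
  then obtain \<zeta> where \<zeta>: "\<zeta> \<in> hset HA" "(\<lambda>n. A.H.nrm (regA (x n) - \<zeta>)) \<longlonglongrightarrow> 0"
    by (rule A.H.Cauchy_imp_limit[of "\<lambda>n. regA (x n)", OF mem(1)])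
  \<comment> \<open>The pairs of \<open>regA (x n)\<close> and \<open>regB (x n)\<close> lie in the
    relation and converge to (\<zeta>, 0).\<close>
  have "graph_closure \<zeta> 0"
  proof (rule graph_closure_limit)
    fix e :: real assume "e > 0"
    then have "\<forall>\<^sub>F n in sequentially. A.H.nrm (regA (x n) - \<zeta>) < e \<and> B.H.nrm (regB (x n)) < e"
      by (intro eventually_conj order_tendstoD(2)[OF \<zeta>(2)] order_tendstoD(2)[OF B_lim])
    then obtain n where n: "A.H.nrm (regA (x n) - \<zeta>) < e" "B.H.nrm (regB (x n)) < e"
      by (auto simp: eventually_sequentially)
    then show "\<exists>a b. graph_closure a b \<and> A.H.nrm (\<zeta> - a) < e \<and> B.H.nrm (0 - b) < e"
      using graph_closure_reg[of "x n"] mem \<zeta>(1) A.H.nrm_minus_commute[of \<zeta> "regA (x n)"]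
      by (intro exI[of _ "regA (x n)"] exI[of _ "regB (x n)"]) simp
  qed (use \<zeta> in auto)
  \<comment> \<open>Each \<open>regA (x n)\<close> is orthogonal to the kernel, which now contains
    \<zeta>; in the limit \<zeta> is orthogonal to itself.\<close>
  then have "hinner HA (regA (x n)) \<zeta> = 0" for n by (rule regA_orthogonal)
  then have "hinner HA \<zeta> \<zeta> = 0"
    using A.H.inner_tendsto[OF mem(1) \<zeta>(1) \<zeta>(1) \<zeta>(2)] by (simp add: LIMSEQ_const_iff)
  then have "\<zeta> = 0" using A.H.inner_self_eq_0[OF \<zeta>(1)] by simp
  then have "(\<lambda>n. complex_of_real ((A.H.nrm (regA (x n)))\<^sup>2)) \<longlonglongrightarrow> of_real (0\<^sup>2)"
    using \<zeta>(2) by (intro tendsto_of_real tendsto_power) simp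
  then show "(\<lambda>n. complex_of_real ((A.H.nrm (regA (x n)))\<^sup>2)) \<longlonglongrightarrow> 0" by simp
qed

end

section \<open>Mutual absolute continuity of the two canonical parts\<close>

theorem theorem3p6:
  fixes scaleE :: "complex \<Rightarrow> 'e::ab_group_add \<Rightarrow> 'e"
    and scaleF :: "complex \<Rightarrow> 'f::ab_group_add \<Rightarrow> 'f"
    and pairing :: "'f \<Rightarrow> 'e \<Rightarrow> complex"
    and A B :: "'e \<Rightarrow> 'f"
    and HA :: "('f, 'h::ab_group_add) completion"
    and HB :: "('f, 'k::ab_group_add) completion"
  assumes "anti_dual_pair scaleE scaleF pairing"
    and "weak_star_sequentially_complete pairing"
    and "A \<in> continuous_operators scaleE scaleF pairing" and "positive_operator pairing A"
    and "B \<in> continuous_operators scaleE scaleF pairing" and "positive_operator pairing B"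
    and "hilbert_completion scaleF pairing A HA"
    and "hilbert_completion scaleF pairing B HB"
  shows "abs_continuous pairing (ac_part scaleF pairing B HB A HA) (ac_part scaleF pairing A HA B HB) \<and>
         abs_continuous pairing (ac_part scaleF pairing A HA B HB) (ac_part scaleF pairing B HB A HA)"
proof
  have lin: "Vector_Spaces.linear scaleE scaleF A" "Vector_Spaces.linear scaleE scaleF B"
    using assms(3,5) by (simp_all add: continuous_operators_def)
  have hilb: "complex_hilbert HA" "complex_hilbert HB"
    using assms(7,8) by (simp_all add: hilbert_completion_def)
  have A: "positive_completion scaleE scaleF pairing A HA"
    by (intro positive_completion.intro positive_completion_axioms.intro hilbert_carrier.intro
        assms(1,2,7) lin hilb)
  have B: "positive_completion scaleE scaleF pairing B HB"
    by (intro positive_completion.intro positive_completion_axioms.intro hilbert_carrier.intro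
        assms(1,2,8) lin hilb)
  show "abs_continuous pairing (ac_part scaleF pairing B HB A HA) (ac_part scaleF pairing A HA B HB)"
    using A B by (intro positive_pair.abs_continuous_ac_parts positive_pair.intro)
  \<comment> \<open>\<open>positive_pair\<close> treats its operators alike, so its instance with B
    in first place gives the reverse relation.\<close>
  show "abs_continuous pairing (ac_part scaleF pairing A HA B HB) (ac_part scaleF pairing B HB A HA)"
    using A B by (intro positive_pair.abs_continuous_ac_parts positive_pair.intro)
qed

end
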